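(* Let $a,b,c,d\in\mathbb R$ be admissible parameters (see context) with $c\neq 0$. Let $\lambda>0$, $m\in(0,1]$, $\sigma\in\mathbb R$, let $n\ge 0$ be an integer, let $j_0,\dots,j_n,k_0,\dots,k_n\in\mathbb R$ (with $j_r=k_r=0$ for $r>n$), and set $$\eta(\xi)=\sum_{r=0}^n j_r\,\mathrm{cn}^r(\lambda\xi,m),\qquad w(\xi)=\sum_{r=0}^n k_r\,\mathrm{cn}^r(\lambda\xi,m).$$ Suppose that $(\eta(x-\sigma t),w(x-\sigma t))$ is a solution of the $abcd$-system, i.e. that for all $\xi\in\mathbb R$ $$-\sigma\eta'+w'+(\eta w)'+a w'''+b\sigma\eta'''=0,\qquad -\sigma w'+\eta'+ww'+c\,\eta'''+d\sigma w'''=0 .$$ Then: (i) If $a^2+b^2\neq 0$, then $j_r=k_r=0$ for all integers $r\ge 3$, so that $$\eta(\xi)=j_0+j_1\mathrm{cn}(\lambda\xi,m)+j_2\mathrm{cn}^2(\lambda\xi,m),\qquad w(\xi)=k_0+k_1\mathrm{cn}(\lambda\xi,m)+k_2\mathrm{cn}^2(\lambda\xi,m).$$ (ii) If $a^2+b^2=0$, then $j_r=0$ for all integers $r\ge 1$ and $k_r=0$ for all integers $r\ge 3$, so that $$\eta(\xi)=j_0,\qquad w(\xi)=k_0+k_1\mathrm{cn}(\lambda\xi,m)+k_2\mathrm{cn}^2(\lambda\xi,m).$$ Consequently, in case (ii) there is no such solution with both components non-constant (only semi-trivial solutions, in which one component is constant, exist).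
   Context: The $abcd$-system for real-valued $\eta(x,t),w(x,t)$, $x,t\in\mathbb R$, is $$\eta_t+w_x+(w\eta)_x+a w_{xxx}-b\eta_{xxt}=0,\qquad w_t+\eta_x+ww_x+c\,\eta_{xxx}-d w_{xxt}=0 .$$ The real parameters $a,b,c,d$ are admissible if for some $\theta\in[0,1]$: $a+b=\tfrac12(\theta^2-\tfrac13)$, $c+d=\tfrac12(1-\theta^2)\ge 0$, and $a+b+c+d=\tfrac13$. A traveling-wave solution has the form $\eta=\eta(\xi)$, $w=w(\xi)$, $\xi=x-\sigma t$; primes denote $d/d\xi$. Jacobi elliptic function convention: for $0\le m\le 1$, with $v=\int_0^\phi (1-m^2\sin^2 t)^{-1/2}dt$, one sets $\mathrm{cn}(v,m)=\cos\phi$, $\mathrm{sn}(v,m)=\sin\phi$; $m$ is the elliptic modulus (so $\mathrm{cn}(v,1)=\mathrm{sech}\,v$). $\mathrm{cn}^0\equiv 1$. *)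

theory Defs
  imports "HOL-Analysis.Analysis"
begin

definition jacobi_integrand :: "real \<Rightarrow> real \<Rightarrow> real" where
  "jacobi_integrand m t = 1 / sqrt (1 - m\<^sup>2 * (sin t)\<^sup>2)"

text \<open>
  The amplitude is the unique \<open>\<phi>\<close> with \<open>v = \<integral>\<^sub>0\<^sup>\<phi> (1 - m\<^sup>2 sin\<^sup>2 t)\<^sup>-\<^sup>1\<^sup>/\<^sup>2 dt\<close>, for
  \<open>0 \<le> m \<le> 1\<close> (\<open>m\<close> is the modulus, not the parameter \<open>m\<^sup>2\<close>). Integrability must be required
  explicitly because a divergent integral has the value 0: for \<open>m = 1\<close> it
  confines \<open>\<phi>\<close> to \<open>-\<pi>/2 < \<phi> < \<pi>/2\<close>, so that \<open>cn (v, 1) = sech v\<close>; for \<open>m < 1\<close> it always holds.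
\<close>

definition jacobi_am :: "real \<Rightarrow> real \<Rightarrow> real" where
  "jacobi_am v m = (THE \<phi>.
     interval_lebesgue_integrable lborel (ereal 0) (ereal \<phi>) (jacobi_integrand m) \<and>
     v = (LBINT t=ereal 0..ereal \<phi>. jacobi_integrand m t))"

definition jacobi_cn :: "real \<Rightarrow> real \<Rightarrow> real" where
  "jacobi_cn v m = cos (jacobi_am v m)"

definition abcd_admissible :: "real \<Rightarrow> real \<Rightarrow> real \<Rightarrow> real \<Rightarrow> bool" where
  "abcd_admissible a b c d \<longleftrightarrow>
     (\<exists>\<theta>\<in>{0..1}. a + b = 1 / 2 * (\<theta>\<^sup>2 - 1 / 3) \<and> c + d = 1 / 2 * (1 - \<theta>\<^sup>2) \<and>
        c + d \<ge> 0 \<and> a + b + c + d = 1 / 3)"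

definition Dx :: "(real \<Rightarrow> real \<Rightarrow> real) \<Rightarrow> real \<Rightarrow> real \<Rightarrow> real" where
  "Dx u = (\<lambda>x t. deriv (\<lambda>y. u y t) x)"

definition Dt :: "(real \<Rightarrow> real \<Rightarrow> real) \<Rightarrow> real \<Rightarrow> real \<Rightarrow> real" where
  "Dt u = (\<lambda>x t. deriv (\<lambda>s. u x s) t)"

definition abcd_system ::
  "real \<Rightarrow> real \<Rightarrow> real \<Rightarrow> real \<Rightarrow> (real \<Rightarrow> real \<Rightarrow> real) \<Rightarrow> (real \<Rightarrow> real \<Rightarrow> real) \<Rightarrow> bool" where
  "abcd_system a b c d \<eta> w \<longleftrightarrow> (\<forall>x t.
     Dt \<eta> x t + Dx w x t + Dx (\<lambda>x t. w x t * \<eta> x t) x t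
       + a * Dx (Dx (Dx w)) x t - b * Dt (Dx (Dx \<eta>)) x t = 0 \<and>
     Dt w x t + Dx \<eta> x t + w x t * Dx w x t
       + c * Dx (Dx (Dx \<eta>)) x t - d * Dt (Dx (Dx w)) x t = 0)"

lemma Dx_travelling:
  fixes f :: "real \<Rightarrow> real"
  assumes "\<And>x. f differentiable at x"
  shows "Dx (\<lambda>x t. f (x - \<sigma> * t)) = (\<lambda>x t. deriv f (x - \<sigma> * t))"
proof (intro ext)
  fix x t
  have "(f has_field_derivative deriv f (x - \<sigma> * t)) (at (x - \<sigma> * t))"
    using assms DERIV_deriv_iff_real_differentiable by blast
  then have "((\<lambda>y. f (y - \<sigma> * t)) has_field_derivative deriv f (x - \<sigma> * t) * 1) (at x)"
    by (rule DERIV_chain2) (auto intro!: derivative_eq_intros)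
  then show "Dx (\<lambda>x t. f (x - \<sigma> * t)) x t = deriv f (x - \<sigma> * t)"
    by (simp add: Dx_def DERIV_imp_deriv)
qed

lemma Dt_travelling:
  fixes f :: "real \<Rightarrow> real"
  assumes "\<And>x. f differentiable at x"
  shows "Dt (\<lambda>x t. f (x - \<sigma> * t)) = (\<lambda>x t. - \<sigma> * deriv f (x - \<sigma> * t))"
proof (intro ext)
  fix x t
  have "(f has_field_derivative deriv f (x - \<sigma> * t)) (at (x - \<sigma> * t))"
    using assms DERIV_deriv_iff_real_differentiable by blast
  then have "((\<lambda>s. f (x - \<sigma> * s)) has_field_derivative deriv f (x - \<sigma> * t) * (- \<sigma>)) (at t)"
    by (rule DERIV_chain2) (auto intro!: derivative_eq_intros)
  then show "Dt (\<lambda>x t. f (x - \<sigma> * t)) x t = - \<sigma> * deriv f (x - \<sigma> * t)"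
    by (simp add: Dt_def DERIV_imp_deriv mult.commute)
qed

text \<open>
  For a travelling wave with smooth profiles, the system is equivalent to a pair of ordinary
  differential equations. Smoothness matters because \<open>deriv\<close> is total.
\<close>

lemma abcd_system_travelling_wave_iff:
  fixes \<eta> w :: "real \<Rightarrow> real"
  assumes "\<And>i x. i < 3 \<Longrightarrow> (deriv ^^ i) \<eta> differentiable at x"
    and "\<And>i x. i < 3 \<Longrightarrow> (deriv ^^ i) w differentiable at x"
  shows "abcd_system a b c d (\<lambda>x t. \<eta> (x - \<sigma> * t)) (\<lambda>x t. w (x - \<sigma> * t))
    \<longleftrightarrow> (\<forall>\<xi>.
     - \<sigma> * deriv \<eta> \<xi> + deriv w \<xi> + deriv (\<lambda>\<xi>. \<eta> \<xi> * w \<xi>) \<xi>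
       + a * (deriv ^^ 3) w \<xi> + b * \<sigma> * (deriv ^^ 3) \<eta> \<xi> = 0 \<and>
     - \<sigma> * deriv w \<xi> + deriv \<eta> \<xi> + w \<xi> * deriv w \<xi>
       + c * (deriv ^^ 3) \<eta> \<xi> + d * \<sigma> * (deriv ^^ 3) w \<xi> = 0)"
proof -
  have e: "\<eta> differentiable at x" "deriv \<eta> differentiable at x" "deriv (deriv \<eta>) differentiable at x"
    and v: "w differentiable at x" "deriv w differentiable at x" "deriv (deriv w) differentiable at x" for x
    using assms(1)[of 0 x] assms(1)[of 1 x] assms(1)[of 2 x]
      assms(2)[of 0 x] assms(2)[of 1 x] assms(2)[of 2 x] by (simp_all add: numeral_2_eq_2)
  have p: "(\<lambda>\<xi>. \<eta> \<xi> * w \<xi>) differentiable at x" for x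
    using e v by simp
  have q: "Dx (\<lambda>x t. w (x - \<sigma> * t) * \<eta> (x - \<sigma> * t)) =
      (\<lambda>x t. deriv (\<lambda>\<xi>. \<eta> \<xi> * w \<xi>) (x - \<sigma> * t))"
    using Dx_travelling[OF p, of \<sigma>] by (subst mult.commute)
  have s: "(\<forall>x t. P (x - \<sigma> * t)) \<longleftrightarrow> (\<forall>\<xi>. P \<xi>)" for P :: "real \<Rightarrow> bool"
    by (metis diff_0_right mult_zero_right)
  show ?thesis
    unfolding abcd_system_def q
      Dx_travelling[OF e(1)] Dx_travelling[OF e(2)] Dx_travelling[OF e(3)]
      Dx_travelling[OF v(1)] Dx_travelling[OF v(2)] Dx_travelling[OF v(3)]
      Dt_travelling[OF e(1)] Dt_travelling[OF e(3)]
      Dt_travelling[OF v(1)] Dt_travelling[OF v(3)]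
    by (subst s[symmetric]) (simp add: numeral_3_eq_3 mult.assoc)
qed

end

theory Submission
  imports Defs
begin

text \<open>
  The function \<open>y = cn\<close> satisfies \<open>y'\<^sup>2 = P(y)\<close> for a quartic \<open>P\<close> with leading coefficient
  \<open>-m\<^sup>2\<close>, hence \<open>(p(y))'' = (L p)(y)\<close>, where \<open>L\<close> maps \<open>y\<^sup>r\<close> to a polynomial with leading term
  \<open>-m\<^sup>2 r (r + 1) y\<^bsup>r+2\<^esup>\<close>. Writing \<open>\<eta> = E(y)\<close>, \<open>w = W(y)\<close>, dividing both equations by \<open>y'\<close> and
  using that \<open>y\<close> takes infinitely many values where \<open>y' \<noteq> 0\<close>, one may integrate to obtain
  polynomial identities
  \<open>-\<sigma> E + W + E W + A L W + B L E = const\<close> and \<open>-\<sigma> W + E + W\<^sup>2/2 + C L E + D L W = const\<close>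
  with \<open>C \<noteq> 0\<close>. If \<open>deg W \<ge> 3\<close>, the second one forces \<open>deg E = 2 deg W - 2\<close>, and then the
  leading term of \<open>E W\<close> in the first one is not cancelled; so \<open>deg W \<le> 2\<close>, and the second
  identity yields \<open>deg E \<le> 2\<close>. If \<open>a = b = 0\<close>, the first identity reads
  \<open>(E + 1) (W - \<sigma>) = const\<close>, so a nonconstant \<open>E\<close> would make \<open>W\<close> constant, contradicting the
  second identity.
\<close>

subsection \<open>The amplitude as inverse of the elliptic integral\<close>

text \<open>The set of amplitudes at which the elliptic integral converges.\<close>

definition am_range :: "real \<Rightarrow> real set" where
  "am_range m = {\<phi>. m < 1 \<or> \<bar>\<phi>\<bar> < pi / 2}"

text \<open>The incomplete elliptic integral of the first kind. For \<open>m = 1\<close> it diverges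
  outside \<open>am_range m\<close> and takes the default value 0 there, so the facts below stay
  inside \<open>am_range m\<close>.\<close>

definition elliptic_F :: "real \<Rightarrow> real \<Rightarrow> real" where
  "elliptic_F m \<phi> = (LBINT t=ereal 0..ereal \<phi>. jacobi_integrand m t)"

lemma am_range_mono: "\<phi> \<in> am_range m \<Longrightarrow> \<bar>t\<bar> \<le> \<bar>\<phi>\<bar> \<Longrightarrow> t \<in> am_range m"
  by (auto simp: am_range_def)

lemma am_range_one: "\<phi> \<in> am_range 1 \<longleftrightarrow> \<bar>\<phi>\<bar> < pi / 2"
  by (simp add: am_range_def)

lemma am_range_less_one: "m < 1 \<Longrightarrow> \<phi> \<in> am_range m"
  by (simp add: am_range_def)

lemma open_am_range: "open (am_range m)"
proof (cases "m < 1")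
  case True
  then show ?thesis by (simp add: am_range_def)
next
  case False
  then have "am_range m = {- (pi / 2)<..<pi / 2}"
    by (auto simp: am_range_def)
  then show ?thesis by simp
qed

section \<open>Regularity of the integrand and of the elliptic integral\<close>

lemma modulus_sin_sq_le_one:
  fixes m \<phi> :: real
  assumes "0 \<le> m" "m \<le> 1"
  shows "m\<^sup>2 * (sin \<phi>)\<^sup>2 \<le> 1"
  by (rule mult_le_one) (use assms in \<open>auto simp: abs_square_le_1 power_le_one\<close>)

lemma modulus_sin_sq_less_one:
  assumes "0 \<le> m" "m \<le> 1" "\<phi> \<in> am_range m"
  shows "m\<^sup>2 * (sin \<phi>)\<^sup>2 < 1"
proof (cases "m < 1")
  case True
  have "m\<^sup>2 * (sin \<phi>)\<^sup>2 \<le> m\<^sup>2 * 1"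
    by (rule mult_left_mono) (auto simp: abs_square_le_1)
  also have "\<dots> < 1"
    using assms True by (simp add: abs_square_less_1)
  finally show ?thesis .
next
  case False
  then have m: "m = 1" using assms by simp
  then have "cos \<phi> > 0"
    using assms by (intro cos_gt_zero_pi) (auto simp: am_range_one)
  then have "(cos \<phi>)\<^sup>2 > 0" by simp
  then show ?thesis using sin_cos_squared_add[of \<phi>] unfolding m one_power2 mult_1 by linarith
qed

lemma jacobi_integrand_nonneg:
  assumes "0 \<le> m" "m \<le> 1"
  shows "0 \<le> jacobi_integrand m t"
  using modulus_sin_sq_le_one[OF assms, of t] by (simp add: jacobi_integrand_def)

lemma jacobi_integrand_ge_one:
  assumes "0 \<le> m" "m \<le> 1" "t \<in> am_range m"
  shows "1 \<le> jacobi_integrand m t"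
  using modulus_sin_sq_less_one[OF assms] by (simp add: jacobi_integrand_def)

lemma isCont_jacobi_integrand:
  assumes "0 \<le> m" "m \<le> 1" "t \<in> am_range m"
  shows "isCont (jacobi_integrand m) t"
  unfolding jacobi_integrand_def
  using modulus_sin_sq_less_one[OF assms] by (intro continuous_intros) auto

lemma jacobi_integrand_integrable:
  assumes "0 \<le> m" "m \<le> 1" "\<phi> \<in> am_range m"
  shows "interval_lebesgue_integrable lborel (ereal 0) (ereal \<phi>) (jacobi_integrand m)"
proof (rule interval_integrable_isCont)
  fix t assume "min 0 \<phi> \<le> t" "t \<le> max 0 \<phi>"
  then show "isCont (jacobi_integrand m) t"
    using am_range_mono[OF assms(3), of t] assms by (intro isCont_jacobi_integrand) auto
qed

lemma DERIV_elliptic_F: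
  assumes m: "0 \<le> m" "m \<le> 1" and \<phi>: "\<phi> \<in> am_range m"
  shows "DERIV (elliptic_F m) \<phi> :> jacobi_integrand m \<phi>"
proof -
  obtain e where e: "e > 0" "ball \<phi> e \<subseteq> am_range m"
    using open_am_range[of m] \<phi> by (meson openE)
  \<comment> \<open>The sign of \<open>\<phi>\<close> decides which of the two points lies in the
    ball. Symmetry of \<open>am_range m\<close> then yields an interval \<open>{-r..r}\<close>
    inside it that has both 0 and \<open>\<phi>\<close> in its interior.\<close>
  have "\<bar>\<phi>\<bar> + e / 2 \<in> am_range m \<or> - \<bar>\<phi>\<bar> - e / 2 \<in> am_range m"
    using e(1) by (cases "\<phi> \<ge> 0") (auto intro!: subsetD[OF e(2)] simp: dist_real_def)
  then have r: "\<bar>\<phi>\<bar> + e / 2 \<in> am_range m"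
    using e(1) am_range_mono[of "- \<bar>\<phi>\<bar> - e / 2" m "\<bar>\<phi>\<bar> + e / 2"] by auto
  define r where "r = \<bar>\<phi>\<bar> + e / 2"
  have "continuous_on {-r..r} (jacobi_integrand m)"
    using m am_range_mono[OF r]
    by (intro continuous_at_imp_continuous_on ballI isCont_jacobi_integrand)
      (auto simp: r_def)
  moreover have "-r < \<phi>" "\<phi> < r" "-r \<le> 0" "0 \<le> r"
    using e(1) by (auto simp: r_def)
  ultimately have "((\<lambda>u. LBINT t=ereal 0..ereal u. jacobi_integrand m t)
      has_vector_derivative jacobi_integrand m \<phi>) (at \<phi> within {-r..r})"
    by (intro interval_integral_FTC2) auto
  moreover have "at \<phi> within {-r..r} = at \<phi>"
    using \<open>-r < \<phi>\<close> \<open>\<phi> < r\<close> by (intro at_within_interior) auto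
  ultimately show ?thesis
    by (simp add: has_real_derivative_iff_has_vector_derivative elliptic_F_def[abs_def])
qed

lemma elliptic_F_zero [simp]: "elliptic_F m 0 = 0"
  by (simp add: elliptic_F_def zero_ereal_def[symmetric])

lemma elliptic_F_strict_mono:
  assumes m: "0 \<le> m" "m \<le> 1" and "x \<in> am_range m" "y \<in> am_range m" "x < y"
  shows "elliptic_F m x < elliptic_F m y"
proof (rule DERIV_pos_imp_increasing[OF \<open>x < y\<close>])
  fix t assume "x \<le> t" "t \<le> y"
  then have "\<bar>t\<bar> \<le> \<bar>x\<bar> \<or> \<bar>t\<bar> \<le> \<bar>y\<bar>" by auto
  then have t: "t \<in> am_range m" using assms am_range_mono by blast
  then show "\<exists>d. DERIV (elliptic_F m) t :> d \<and> d > 0"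
    using DERIV_elliptic_F[OF m t] jacobi_integrand_ge_one[OF m t] by force
qed

lemma elliptic_F_inj:
  assumes m: "0 \<le> m" "m \<le> 1"
  shows "inj_on (elliptic_F m) (am_range m)"
  by (rule linorder_inj_onI') (use elliptic_F_strict_mono[OF m] in fastforce)

text \<open>For \<open>m = 1\<close> the integrand is the secant on this range, and
  \<open>artanh (sin t)\<close>, the inverse Gudermannian function, is an antiderivative of
  it.\<close>

lemma elliptic_F_one:
  assumes "\<bar>\<phi>\<bar> < pi / 2"
  shows "elliptic_F 1 \<phi> = artanh (sin \<phi>)"
proof -
  have cont: "continuous_on {min 0 \<phi>..max 0 \<phi>} (jacobi_integrand 1)"
    using assms
    by (intro continuous_at_imp_continuous_on ballI isCont_jacobi_integrand)
      (auto simp: am_range_one)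
  have "(artanh \<circ> sin has_vector_derivative jacobi_integrand 1 t)
      (at t within {min 0 \<phi>..max 0 \<phi>})" if "min 0 \<phi> \<le> t" "t \<le> max 0 \<phi>" for t
  proof -
    have c: "cos t > 0" using assms that by (intro cos_gt_zero_pi) auto
    then have "(cos t)\<^sup>2 > 0" by simp
    then have s: "(sin t)\<^sup>2 < 1" using sin_cos_squared_add[of t] by linarith
    have "1 - (sin t)\<^sup>2 = cos t * cos t"
      using sin_cos_squared_add[of t] unfolding power2_eq_square by linarith
    then have eq: "jacobi_integrand 1 t = 1 / (1 - (sin t)\<^sup>2) * cos t"
      using c by (simp add: jacobi_integrand_def)
    have "(artanh \<circ> sin has_field_derivative 1 / (1 - (sin t)\<^sup>2) * cos t) (at t)"
      using s by (intro DERIV_chain artanh_real_has_field_derivative DERIV_sin)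
        (simp add: abs_square_less_1)
    then show ?thesis
      unfolding eq by (metis has_real_derivative_iff_has_vector_derivative has_vector_derivative_at_within)
  qed
  from interval_integral_FTC_finite[OF cont this]
  show ?thesis by (simp add: elliptic_F_def)
qed

lemma arcsin_tanh_bounds: "\<bar>arcsin (tanh v)\<bar> < pi / 2" for v :: real
  using arcsin_lt_bounded[OF tanh_real_gt_neg1[of v] tanh_real_lt_1[of v]] by auto

lemma elliptic_F_one_arcsin_tanh: "elliptic_F 1 (arcsin (tanh v)) = v"
  by (simp add: elliptic_F_one[OF arcsin_tanh_bounds] artanh_tanh_real
      less_imp_le tanh_real_gt_neg1 tanh_real_lt_1)

text \<open>For \<open>m < 1\<close> the integrand is at least 1, so
  \<open>elliptic_F m x - x\<close> is nondecreasing and zero at 0, and the intermediate value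
  theorem applies on \<open>{-\<bar>v\<bar>..\<bar>v\<bar>}\<close>. For \<open>m = 1\<close> the
  Gudermannian function gives the preimage.\<close>

lemma elliptic_F_surj:
  assumes m: "0 \<le> m" "m \<le> 1"
  shows "\<exists>\<phi>\<in>am_range m. elliptic_F m \<phi> = v"
proof (cases "m < 1")
  case True
  then have R: "t \<in> am_range m" for t by (rule am_range_less_one)
  have mono: "elliptic_F m x - x \<le> elliptic_F m y - y" if "x \<le> y" for x y
  proof (rule DERIV_nonneg_imp_nondecreasing[OF that])
    fix t
    show "\<exists>d. DERIV (\<lambda>t. elliptic_F m t - t) t :> d \<and> 0 \<le> d"
      using jacobi_integrand_ge_one[OF m R[of t]]
      by (intro exI[of _ "jacobi_integrand m t - 1"])
        (auto intro!: derivative_eq_intros DERIV_elliptic_F m R)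
  qed
  have "\<exists>\<phi>. - \<bar>v\<bar> \<le> \<phi> \<and> \<phi> \<le> \<bar>v\<bar> \<and> elliptic_F m \<phi> = v"
  proof (rule IVT)
    show "elliptic_F m (- \<bar>v\<bar>) \<le> v" "v \<le> elliptic_F m \<bar>v\<bar>"
      using mono[of "- \<bar>v\<bar>" 0] mono[of 0 "\<bar>v\<bar>"] by auto
  qed (use DERIV_elliptic_F[OF m R] DERIV_isCont in auto)
  then show ?thesis using R by blast
next
  case False
  then have "m = 1" using m by simp
  then show ?thesis
    using arcsin_tanh_bounds[of v] elliptic_F_one_arcsin_tanh[of v] by (auto simp: am_range_one)
qed

text \<open>The integrand is nonnegative, so a finite integral up to \<open>\<phi>\<close> would
  bound the integral up to \<open>arcsin (tanh v)\<close>, which equals \<open>v\<close>, for every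
  \<open>v \<ge> 0\<close>.\<close>

lemma not_jacobi_integrand_one_integrable_pos:
  assumes "pi / 2 \<le> \<phi>"
  shows "\<not> interval_lebesgue_integrable lborel (ereal 0) (ereal \<phi>) (jacobi_integrand 1)"
proof
  assume "interval_lebesgue_integrable lborel (ereal 0) (ereal \<phi>) (jacobi_integrand 1)"
  moreover have "0 \<le> \<phi>" using assms pi_gt_zero by linarith
  ultimately have int: "set_integrable lborel (einterval 0 \<phi>) (jacobi_integrand 1)"
    by (simp add: interval_lebesgue_integrable_def zero_ereal_def)
  define C where "C = (LINT t:einterval 0 \<phi>|lborel. jacobi_integrand 1 t)"
  have "v \<le> C" if v: "v \<ge> 0" for v
  proof -
    define x where "x = arcsin (tanh v)"
    have x: "0 \<le> x" "x < pi / 2"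
      using v arcsin_tanh_bounds[of v] tanh_real_lt_1[of v]
      by (auto simp: x_def intro!: arcsin_nonneg)
    have sub: "einterval 0 x \<subseteq> einterval 0 \<phi>"
      using x assms by (auto simp: einterval_def)
    have "v = (LINT t:einterval 0 x|lborel. jacobi_integrand 1 t)"
      using elliptic_F_one_arcsin_tanh[of v] x
      by (simp add: elliptic_F_def x_def interval_lebesgue_integral_def zero_ereal_def)
    also have "\<dots> \<le> C"
      unfolding C_def set_lebesgue_integral_def
    proof (rule integral_mono)
      show "integrable lborel (\<lambda>t. indicat_real (einterval 0 x) t *\<^sub>R jacobi_integrand 1 t)"
        using set_integrable_subset[OF int _ sub] by (simp add: set_integrable_def)
      show "integrable lborel (\<lambda>t. indicat_real (einterval 0 \<phi>) t *\<^sub>R jacobi_integrand 1 t)"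
        using int by (simp add: set_integrable_def)
      show "indicat_real (einterval 0 x) t *\<^sub>R jacobi_integrand 1 t
          \<le> indicat_real (einterval 0 \<phi>) t *\<^sub>R jacobi_integrand 1 t" for t
        using sub jacobi_integrand_nonneg[of 1 t] by (auto simp: indicator_def)
    qed
    finally show ?thesis .
  qed
  from this[of "\<bar>C\<bar> + 1"] show False by linarith
qed

text \<open>Turns the integrability clause in \<open>jacobi_am\<close> into membership in
  \<open>am_range m\<close>, where \<open>elliptic_F m\<close> is injective, so that the definite
  description can be evaluated.\<close>

lemma jacobi_integrand_integrable_iff:
  assumes m: "0 \<le> m" "m \<le> 1"
  shows "interval_lebesgue_integrable lborel (ereal 0) (ereal \<phi>) (jacobi_integrand m)
    \<longleftrightarrow> \<phi> \<in> am_range m"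
proof
  assume int: "interval_lebesgue_integrable lborel (ereal 0) (ereal \<phi>) (jacobi_integrand m)"
  show "\<phi> \<in> am_range m"
  proof (rule ccontr)
    assume "\<phi> \<notin> am_range m"
    then have m1: "m = 1" and "pi / 2 \<le> \<bar>\<phi>\<bar>" using m by (auto simp: am_range_def)
    \<comment> \<open>Evenness carries integrability from \<open>\<phi>\<close> to
      \<open>- \<phi>\<close>; one of the two is at least \<open>pi / 2\<close>.\<close>
    have even: "(\<lambda>t. jacobi_integrand 1 (- t)) = jacobi_integrand 1"
      by (simp add: jacobi_integrand_def fun_eq_iff)
    have "interval_lebesgue_integrable lborel (ereal 0) (ereal (- \<phi>)) (jacobi_integrand 1)"
      using int interval_integrable_mirror[of 0 "ereal \<phi>" "jacobi_integrand 1"]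
        interval_integrable_endpoints_reverse[of "ereal (- \<phi>)" 0 "jacobi_integrand 1"]
      by (simp add: even m1 zero_ereal_def[symmetric])
    then show False
      using not_jacobi_integrand_one_integrable_pos[of \<phi>]
        not_jacobi_integrand_one_integrable_pos[of "- \<phi>"] int m1 \<open>pi / 2 \<le> \<bar>\<phi>\<bar>\<close>
      by (cases "\<phi> \<ge> 0") auto
  qed
qed (rule jacobi_integrand_integrable[OF m])

section \<open>The amplitude and its derivative\<close>

lemma jacobi_am_eqI:
  assumes m: "0 \<le> m" "m \<le> 1" and \<phi>: "\<phi> \<in> am_range m" and v: "elliptic_F m \<phi> = v"
  shows "jacobi_am v m = \<phi>"
  unfolding jacobi_am_def jacobi_integrand_integrable_iff[OF m] elliptic_F_def[symmetric]
  using \<phi> v inj_onD[OF elliptic_F_inj[OF m]] by (intro the_equality) auto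

lemma
  assumes m: "0 \<le> m" "m \<le> 1"
  shows jacobi_am_in_range: "jacobi_am v m \<in> am_range m"
    and elliptic_F_jacobi_am: "elliptic_F m (jacobi_am v m) = v"
  using elliptic_F_surj[OF m, of v] jacobi_am_eqI[OF m] by auto

lemma isCont_jacobi_am:
  assumes m: "0 \<le> m" "m \<le> 1"
  shows "isCont (\<lambda>v. jacobi_am v m) v"
proof -
  define \<phi> where "\<phi> = jacobi_am v m"
  obtain e where e: "e > 0" "cball \<phi> e \<subseteq> am_range m"
    using open_am_range[of m] jacobi_am_in_range[OF m, of v]
    by (metis open_contains_cball \<phi>_def)
  have R: "z \<in> am_range m" if "\<bar>z - \<phi>\<bar> \<le> e" for z
    using that e(2) by (auto simp: dist_real_def abs_minus_commute)
  have "isCont (\<lambda>v. jacobi_am v m) (elliptic_F m \<phi>)"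
    by (rule isCont_inverse_function[OF e(1)])
      (use R jacobi_am_eqI[OF m] DERIV_isCont[OF DERIV_elliptic_F[OF m]] in auto)
  then show ?thesis by (simp add: \<phi>_def elliptic_F_jacobi_am[OF m])
qed

lemma DERIV_jacobi_am:
  assumes m: "0 \<le> m" "m \<le> 1"
  shows "DERIV (\<lambda>v. jacobi_am v m) v :> sqrt (1 - m\<^sup>2 * (sin (jacobi_am v m))\<^sup>2)"
proof -
  have "DERIV (\<lambda>v. jacobi_am v m) v :> inverse (jacobi_integrand m (jacobi_am v m))"
  proof (rule DERIV_inverse_function[of "elliptic_F m"])
    show "DERIV (elliptic_F m) (jacobi_am v m) :> jacobi_integrand m (jacobi_am v m)"
      by (intro DERIV_elliptic_F m jacobi_am_in_range)
    show "jacobi_integrand m (jacobi_am v m) \<noteq> 0"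
      using jacobi_integrand_ge_one[OF m jacobi_am_in_range[OF m, of v]] by linarith
    show "v - 1 < v" "v < v + 1" by auto
  qed (use elliptic_F_jacobi_am[OF m] isCont_jacobi_am[OF m] in auto)
  then show ?thesis by (simp add: jacobi_integrand_def)
qed

subsection \<open>Polynomials in cn\<close>

text \<open>From \<open>cn'\<^sup>2 = (1 - cn\<^sup>2) (1 - m\<^sup>2 + m\<^sup>2 cn\<^sup>2)\<close>.\<close>

definition cn_quartic :: "real \<Rightarrow> real poly" where
  "cn_quartic m = [:1 - m\<^sup>2, 0, 2 * m\<^sup>2 - 1, 0, - m\<^sup>2:]"

definition cn_quartic_half_deriv :: "real \<Rightarrow> real poly" where
  "cn_quartic_half_deriv m = [:0, 2 * m\<^sup>2 - 1, 0, - 2 * m\<^sup>2:]"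

text \<open>This is - sn dn. It is kept as a separate factor; its square and its derivative are
  polynomials in cn.\<close>

definition jacobi_cn_deriv :: "real \<Rightarrow> real \<Rightarrow> real" where
  "jacobi_cn_deriv v m =
    - sin (jacobi_am v m) * sqrt (1 - m\<^sup>2 * (sin (jacobi_am v m))\<^sup>2)"

lemma DERIV_jacobi_cn:
  assumes m: "0 \<le> m" "m \<le> 1"
  shows "DERIV (\<lambda>v. jacobi_cn v m) v :> jacobi_cn_deriv v m"
  unfolding jacobi_cn_def jacobi_cn_deriv_def
  by (auto intro!: derivative_eq_intros DERIV_jacobi_am m)

lemma jacobi_cn_deriv_sq:
  assumes m: "0 \<le> m" "m \<le> 1"
  shows "(jacobi_cn_deriv v m)\<^sup>2 = poly (cn_quartic m) (jacobi_cn v m)"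
proof -
  have "(jacobi_cn_deriv v m)\<^sup>2 = (sin (jacobi_am v m))\<^sup>2 * (1 - m\<^sup>2 * (sin (jacobi_am v m))\<^sup>2)"
    using modulus_sin_sq_le_one[OF m, of "jacobi_am v m"]
    by (simp add: jacobi_cn_deriv_def power_mult_distrib)
  also have "\<dots> = poly (cn_quartic m) (jacobi_cn v m)"
    unfolding sin_squared_eq jacobi_cn_def cn_quartic_def
    by (simp add: algebra_simps power2_eq_square)
  finally show ?thesis .
qed

text \<open>Differentiating \<open>y'\<^sup>2 = P(y)\<close> suggests
  \<open>y'' = P'(y) / 2\<close>, but that argument divides by \<open>y'\<close>, which has zeros.
  The derivative is therefore computed directly from the amplitude.\<close>

lemma DERIV_jacobi_cn_deriv:
  assumes m: "0 \<le> m" "m \<le> 1"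
  shows "DERIV (\<lambda>v. jacobi_cn_deriv v m) v :> poly (cn_quartic_half_deriv m) (jacobi_cn v m)"
proof -
  define s where "s = sin (jacobi_am v m)"
  define c where "c = cos (jacobi_am v m)"
  define q where "q = sqrt (1 - m\<^sup>2 * s\<^sup>2)"
  have pos: "0 < 1 - m\<^sup>2 * s\<^sup>2"
    using modulus_sin_sq_less_one[OF m jacobi_am_in_range[OF m, of v]] by (simp add: s_def)
  then have q: "q > 0" "q\<^sup>2 = 1 - m\<^sup>2 * s\<^sup>2" by (simp_all add: q_def)
  have am: "DERIV (\<lambda>v. jacobi_am v m) v :> q"
    using DERIV_jacobi_am[OF m, of v] by (simp add: q_def s_def)
  have ds: "DERIV (\<lambda>v. sin (jacobi_am v m)) v :> c * q"
    using am by (auto intro!: derivative_eq_intros simp: c_def)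
  have "DERIV (\<lambda>v. 1 - m\<^sup>2 * (sin (jacobi_am v m))\<^sup>2) v :> - (m\<^sup>2 * (2 * s * (c * q)))"
    using DERIV_diff[OF DERIV_const DERIV_cmult[OF DERIV_power[OF ds, of 2]], of 1 "m\<^sup>2"]
    by (simp add: s_def mult_ac)
  from DERIV_chain2[where g = "\<lambda>v. 1 - m\<^sup>2 * (sin (jacobi_am v m))\<^sup>2",
      OF DERIV_real_sqrt this] pos
  have "DERIV (\<lambda>v. sqrt (1 - m\<^sup>2 * (sin (jacobi_am v m))\<^sup>2)) v
      :> inverse q / 2 * - (m\<^sup>2 * (2 * s * (c * q)))"
    by (simp add: q_def s_def)
  also have "inverse q / 2 * - (m\<^sup>2 * (2 * s * (c * q))) = - (m\<^sup>2 * s * c)"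
    using q by (simp add: field_simps)
  finally have dq: "DERIV (\<lambda>v. sqrt (1 - m\<^sup>2 * (sin (jacobi_am v m))\<^sup>2)) v :> - (m\<^sup>2 * s * c)" .
  have "DERIV (\<lambda>v. jacobi_cn_deriv v m) v :> - (c * q) * q + - s * - (m\<^sup>2 * s * c)"
    unfolding jacobi_cn_deriv_def
    using DERIV_mult[OF DERIV_minus[OF ds] dq] by (simp add: q_def s_def algebra_simps)
  also have "- (c * q) * q + - s * - (m\<^sup>2 * s * c) = - c * q\<^sup>2 + m\<^sup>2 * c * s\<^sup>2"
    by (simp add: power2_eq_square)
  also have "\<dots> = - c * (1 - 2 * m\<^sup>2 * (1 - c\<^sup>2))"
    unfolding q(2) by (simp add: s_def c_def sin_squared_eq algebra_simps)
  also have "\<dots> = poly (cn_quartic_half_deriv m) (jacobi_cn v m)"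
    by (simp add: cn_quartic_half_deriv_def jacobi_cn_def c_def algebra_simps power2_eq_square)
  finally show ?thesis .
qed

text \<open>Each \<open>x\<close> in (0,1) is attained at amplitude \<open>arccos x\<close>, which
  lies strictly between 0 and \<open>pi / 2\<close>: inside \<open>am_range m\<close> even for
  \<open>m = 1\<close>, and with nonzero sine.\<close>

lemma infinite_jacobi_cn_values:
  assumes m: "0 \<le> m" "m \<le> 1"
  shows "infinite {jacobi_cn v m | v. jacobi_cn_deriv v m \<noteq> 0}"
proof -
  have "x \<in> {jacobi_cn v m | v. jacobi_cn_deriv v m \<noteq> 0}" if x: "x \<in> {0<..<1}" for x
  proof -
    define \<phi> where "\<phi> = arccos x"
    have \<phi>: "0 < \<phi>" "\<phi> < pi / 2"
      using x arccos_lt_bounded[of x] arccos_less_arccos[of 0 x] by (auto simp: \<phi>_def)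
    then have R: "\<phi> \<in> am_range m" by (auto simp: am_range_def)
    have am: "jacobi_am (elliptic_F m \<phi>) m = \<phi>" by (rule jacobi_am_eqI[OF m R refl])
    have "jacobi_cn (elliptic_F m \<phi>) m = x"
      using x unfolding jacobi_cn_def am by (simp add: \<phi>_def)
    moreover have "sin \<phi> > 0" using \<phi> by (intro sin_gt_zero) auto
    then have "jacobi_cn_deriv (elliptic_F m \<phi>) m \<noteq> 0"
      using modulus_sin_sq_less_one[OF m R] by (simp add: jacobi_cn_deriv_def am)
    ultimately show ?thesis by blast
  qed
  then have "{0<..<1} \<subseteq> {jacobi_cn v m | v. jacobi_cn_deriv v m \<noteq> 0}" by blast
  then show ?thesis
    by (rule infinite_super) (simp add: infinite_Ioo)
qed

text \<open>The operator \<open>L\<close> on polynomials with \<open>(p(cn))'' = (L p)(cn)\<close>.\<close>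

definition cn_op :: "real \<Rightarrow> real poly \<Rightarrow> real poly" where
  "cn_op m p = pderiv (pderiv p) * cn_quartic m + pderiv p * cn_quartic_half_deriv m"

text \<open>The image of \<open>y^r\<close> is \<open>(1 - m\<^sup>2) r (r - 1) y^(r-2) + (2
  m\<^sup>2 - 1) r\<^sup>2 y^r - m\<^sup>2 r (r + 1) y^(r+2)\<close>; the formula collects the
  contributions to \<open>y^(i+2)\<close>.\<close>

lemma coeff_cn_op:
  "coeff (cn_op m p) (i + 2) = (1 - m\<^sup>2) * (i + 4) * (i + 3) * coeff p (i + 4)
     + (2 * m\<^sup>2 - 1) * (i + 2)\<^sup>2 * coeff p (i + 2) - m\<^sup>2 * i * (i + 1) * coeff p i"
proof -
  define q where "q = pderiv (pderiv p)"
  define h where "h = pderiv p"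
  have cn_op: "cn_op m p =
      smult (1 - m\<^sup>2) q + pCons 0 (pCons 0 (smult (2 * m\<^sup>2 - 1) q + pCons 0 (pCons 0 (smult (- m\<^sup>2) q))))
      + pCons 0 (smult (2 * m\<^sup>2 - 1) h + pCons 0 (pCons 0 (smult (- 2 * m\<^sup>2) h)))"
    by (simp add: cn_op_def cn_quartic_def cn_quartic_half_deriv_def q_def h_def)
  have h: "coeff h r = (r + 1) * coeff p (r + 1)" for r
    by (simp add: h_def coeff_pderiv)
  have q: "coeff q r = (r + 1) * (r + 2) * coeff p (r + 2)" for r
    by (simp add: q_def coeff_pderiv algebra_simps)
  \<comment> \<open>The shifted summands involve the coefficients of \<open>q\<close> at
    \<open>i - 2\<close> and of \<open>h\<close> at \<open>i - 1\<close>, so small \<open>i\<close>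
    is treated separately.\<close>
  consider "i = 0" | "i = 1" | r where "i = r + 2"
    by (metis One_nat_def add_2_eq_Suc' not0_implies_Suc)
  then show ?thesis
  proof cases
    case 3
    then have "coeff (cn_op m p) (i + 2) = (1 - m\<^sup>2) * coeff q (r + 4)
        + (2 * m\<^sup>2 - 1) * coeff q (r + 2) - m\<^sup>2 * coeff q r
        + (2 * m\<^sup>2 - 1) * coeff h (r + 3) - 2 * m\<^sup>2 * coeff h (r + 1)"
      by (simp add: cn_op eval_nat_numeral)
    then show ?thesis
      unfolding q h 3 by (simp add: eval_nat_numeral algebra_simps)
  qed (simp_all add: cn_op q h eval_nat_numeral algebra_simps)
qed

section \<open>Derivatives of polynomials in cn\<close>

lemma DERIV_poly_cn:
  assumes m: "0 \<le> m" "m \<le> 1"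
  shows "DERIV (\<lambda>x. poly p (jacobi_cn (l * x) m)) x
    :> l * (poly (pderiv p) (jacobi_cn (l * x) m) * jacobi_cn_deriv (l * x) m)"
proof -
  have "DERIV (\<lambda>x. jacobi_cn (l * x) m) x :> jacobi_cn_deriv (l * x) m * l"
    by (rule DERIV_chain2[OF DERIV_jacobi_cn[OF m]]) (auto intro!: derivative_eq_intros)
  from DERIV_chain2[OF poly_DERIV this] show ?thesis by (simp add: mult_ac)
qed

lemma deriv_poly_cn:
  assumes m: "0 \<le> m" "m \<le> 1"
  shows "deriv (\<lambda>x. poly p (jacobi_cn (l * x) m))
    = (\<lambda>x. l * (poly (pderiv p) (jacobi_cn (l * x) m) * jacobi_cn_deriv (l * x) m))"
  using DERIV_imp_deriv[OF DERIV_poly_cn[OF m]] by (simp add: fun_eq_iff)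

lemma deriv2_poly_cn:
  assumes m: "0 \<le> m" "m \<le> 1"
  shows "deriv (\<lambda>x. l * (poly (pderiv p) (jacobi_cn (l * x) m) * jacobi_cn_deriv (l * x) m))
    = (\<lambda>x. l\<^sup>2 * poly (cn_op m p) (jacobi_cn (l * x) m))"
proof
  fix x
  have z: "DERIV (\<lambda>x. jacobi_cn_deriv (l * x) m) x
      :> poly (cn_quartic_half_deriv m) (jacobi_cn (l * x) m) * l"
    by (rule DERIV_chain2[OF DERIV_jacobi_cn_deriv[OF m]]) (auto intro!: derivative_eq_intros)
  have "DERIV (\<lambda>x. l * (poly (pderiv p) (jacobi_cn (l * x) m) * jacobi_cn_deriv (l * x) m)) x
      :> l\<^sup>2 * (poly (pderiv (pderiv p)) (jacobi_cn (l * x) m) * (jacobi_cn_deriv (l * x) m)\<^sup>2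
        + poly (pderiv p) (jacobi_cn (l * x) m) * poly (cn_quartic_half_deriv m) (jacobi_cn (l * x) m))"
    by (rule DERIV_cong[OF DERIV_cmult[OF DERIV_mult[OF DERIV_poly_cn[OF m] z]]])
      (simp add: power2_eq_square algebra_simps)
  then show "deriv (\<lambda>x. l * (poly (pderiv p) (jacobi_cn (l * x) m) * jacobi_cn_deriv (l * x) m)) x
      = l\<^sup>2 * poly (cn_op m p) (jacobi_cn (l * x) m)"
    unfolding jacobi_cn_deriv_sq[OF m] by (simp add: cn_op_def DERIV_imp_deriv)
qed

text \<open>Two derivatives give a polynomial in cn again, so the third one has the same factor
  \<open>l * jacobi_cn_deriv (l * x) m\<close> as the first. This makes each wave equation a single
  polynomial times that factor.\<close>

lemma deriv3_poly_cn:
  assumes m: "0 \<le> m" "m \<le> 1"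
  shows "(deriv ^^ 3) (\<lambda>x. poly p (jacobi_cn (l * x) m)) x
    = l * poly (smult (l\<^sup>2) (pderiv (cn_op m p))) (jacobi_cn (l * x) m) * jacobi_cn_deriv (l * x) m"
proof -
  have "(deriv ^^ 3) (\<lambda>x. poly p (jacobi_cn (l * x) m))
      = deriv (deriv (deriv (\<lambda>x. poly p (jacobi_cn (l * x) m))))"
    by (simp add: eval_nat_numeral)
  also have "\<dots> = deriv (\<lambda>x. l\<^sup>2 * poly (cn_op m p) (jacobi_cn (l * x) m))"
    by (simp only: deriv_poly_cn[OF m] deriv2_poly_cn[OF m])
  finally show ?thesis
    using deriv_poly_cn[OF m, of "smult (l\<^sup>2) (cn_op m p)" l]
    by (simp add: pderiv_smult mult_ac)
qed

text \<open>The derivative factor can be cancelled only where it is nonzero, but cn still takes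
  infinitely many values there, and all of them are roots of \<open>p\<close>.\<close>

lemma poly_cn_identity:
  assumes m: "0 \<le> m" "m \<le> 1" and l: "l \<noteq> 0"
    and zero: "\<And>x. l * poly p (jacobi_cn (l * x) m) * jacobi_cn_deriv (l * x) m = 0"
  shows "p = 0"
proof (rule ccontr)
  assume "p \<noteq> 0"
  have "poly p (jacobi_cn v m) = 0" if "jacobi_cn_deriv v m \<noteq> 0" for v
    using zero[of "v / l"] l that by simp
  then have "{jacobi_cn v m | v. jacobi_cn_deriv v m \<noteq> 0} \<subseteq> {y. poly p y = 0}" by auto
  then show False
    using poly_roots_finite[OF \<open>p \<noteq> 0\<close>] infinite_jacobi_cn_values[OF m] finite_subset by blast
qed

lemma coeff_cn_op_eq_0:
  assumes "degree p + 2 < i"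
  shows "coeff (cn_op m p) i = 0"
proof -
  obtain r where "i = r + 2" "degree p < r"
    using assms by (auto simp: less_iff_Suc_add)
  then show ?thesis by (simp only: coeff_cn_op) (simp add: coeff_eq_0)
qed

text \<open>For \<open>m \<noteq> 0\<close> and nonconstant \<open>p\<close> this is nonzero, so the
  operator raises the degree by exactly two.\<close>

lemma coeff_cn_op_top:
  "coeff (cn_op m p) (degree p + 2) = - (m\<^sup>2 * degree p * (degree p + 1) * lead_coeff p)"
  using coeff_cn_op[of m p "degree p"] by (simp add: coeff_eq_0)

subsection \<open>Comparison of leading coefficients\<close>

text \<open>If \<open>E\<close> exceeded the bound, \<open>smult C (cn_op m E)\<close> would be the
  only term reaching degree \<open>degree E + 2\<close>, with nothing to cancel its top
  coefficient.\<close>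

lemma degree_le_second_equation:
  assumes m: "m \<noteq> 0" and C: "C \<noteq> 0" and E: "degree E > 0"
    and eq: "degree (smult (- \<sigma>) W + E + smult (1/2) (W * W)
               + smult C (cn_op m E) + smult D (cn_op m W)) = 0"
  shows "degree E \<le> max (degree W) (2 * degree W - 2)"
proof (rule ccontr)
  assume "\<not> ?thesis"
  \<comment> \<open>Truncated subtraction is harmless: for \<open>degree W = 0\<close> the second
    inequality is trivial.\<close>
  then have *: "degree W < degree E" "degree W + degree W < degree E + 2" by auto
  have "coeff (W * W) (degree E + 2) = 0"
    by (rule coeff_eq_0, rule le_less_trans[OF degree_mult_le *(2)])
  then have "C * (m\<^sup>2 * degree E * (degree E + 1) * lead_coeff E) = 0"
    using coeff_eq_0[of _ "degree E + 2", OF eq[THEN eq_refl, THEN le_less_trans]] *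
    by (simp add: coeff_cn_op_top[unfolded add_2_eq_Suc'] coeff_cn_op_eq_0 coeff_eq_0)
  then show False using m C E by auto
qed

lemma degree_le_two:
  assumes m: "m \<noteq> 0" and C: "C \<noteq> 0"
    and eq1: "degree (smult (- \<sigma>) E + W + E * W + smult A (cn_op m W) + smult B (cn_op m E)) = 0"
    and eq2: "degree (smult (- \<sigma>) W + E + smult (1/2) (W * W)
               + smult C (cn_op m E) + smult D (cn_op m W)) = 0"
  shows "degree W \<le> 2" "degree E \<le> 2"
proof -
  note E = degree_le_second_equation[OF m C _ eq2]
  show "degree W \<le> 2"
  proof (rule ccontr)
    assume W: "\<not> degree W \<le> 2"
    \<comment> \<open>Otherwise \<open>W * W\<close> dominates: \<open>cn_op m W\<close> has degree
      at most \<open>degree W + 2\<close>, which is below \<open>2 * degree W\<close> since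
      \<open>degree W \<ge> 3\<close>.\<close>
    have Egt: "2 * degree W \<le> degree E + 2"
    proof (rule ccontr)
      assume "\<not> ?thesis"
      then have "degree E + 2 < degree W + degree W" by simp
      moreover have "coeff (W * W) (degree W + degree W) = lead_coeff W * lead_coeff W"
        by (rule coeff_mult_degree_sum)
      ultimately have "lead_coeff W * lead_coeff W = 0"
        using coeff_eq_0[of _ "degree W + degree W", OF eq2[THEN eq_refl, THEN le_less_trans]] W
        by (simp add: coeff_cn_op_eq_0 coeff_eq_0)
      then show False using W by auto
    qed
    have "degree E > 0" using Egt W by linarith
    then have "degree E \<le> 2 * degree W - 2" using E W by (auto simp: max_def split: if_splits)
    \<comment> \<open>Here \<open>degree W \<ge> 3\<close> and \<open>degree E \<ge> 4\<close>, so
      \<open>E * W\<close> outgrows both \<open>cn_op\<close> terms of the first equation.\<close>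
    then have "degree E + 2 < degree E + degree W" "degree W + 2 < degree E + degree W"
      using Egt W by linarith+
    moreover have "coeff (E * W) (degree E + degree W) = lead_coeff E * lead_coeff W"
      by (rule coeff_mult_degree_sum)
    ultimately have "lead_coeff E * lead_coeff W = 0"
      using coeff_eq_0[of _ "degree E + degree W", OF eq1[THEN eq_refl, THEN le_less_trans]] W
      by (simp add: coeff_cn_op_eq_0 coeff_eq_0)
    then show False using W \<open>degree E > 0\<close> by auto
  qed
  then show "degree E \<le> 2" using E by (cases "degree E = 0") auto
qed

lemma degree_eq_zero:
  fixes E W :: "real poly"
  assumes m: "m \<noteq> 0" and C: "C \<noteq> 0"
    and eq1: "degree (smult (- \<sigma>) E + W + E * W) = 0"
    and eq2: "degree (smult (- \<sigma>) W + E + smult (1/2) (W * W)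
               + smult C (cn_op m E) + smult D (cn_op m W)) = 0"
  shows "degree E = 0"
proof (rule ccontr)
  assume E: "degree E \<noteq> 0"
  have E1: "degree (E + 1) = degree E" using E by (intro degree_add_eq_left) auto
  \<comment> \<open>Subtracting the constant \<open>\<sigma>\<close> completes the product. A
    product of degree 0 with a nonconstant factor \<open>E + 1\<close> forces the other factor to
    vanish.\<close>
  have "(E + 1) * (W - [:\<sigma>:]) = (smult (- \<sigma>) E + W + E * W) - [:\<sigma>:]"
    by (simp add: algebra_simps smult_add_right one_pCons)
  also have "degree \<dots> = 0"
    using degree_diff_le[of _ 0 "[:\<sigma>:]"] eq1 by simp
  finally have "W - [:\<sigma>:] = 0"
    using E E1 degree_mult_eq[of "E + 1" "W - [:\<sigma>:]"] by (metis add_is_0 degree_0)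
  then have "degree W = 0" by simp
  then show False
    using degree_le_second_equation[OF m C _ eq2] E by simp
qed

text \<open>Each left-hand side is the derivative of a polynomial \<open>R\<close> in cn, so
  \<open>pderiv R = 0\<close>. Integration is expressed as \<open>degree R = 0\<close>, which avoids
  naming the constant; \<open>w w'\<close> integrates to half of \<open>W * W\<close>.\<close>

lemma poly_travelling_wave:
  assumes m: "0 \<le> m" "m \<le> 1" and l: "l \<noteq> 0"
    and \<eta>: "\<eta> = (\<lambda>x. poly E (jacobi_cn (l * x) m))"
    and w: "w = (\<lambda>x. poly W (jacobi_cn (l * x) m))"
  shows "(\<And>\<xi>. - \<sigma> * deriv \<eta> \<xi> + deriv w \<xi> + deriv (\<lambda>\<xi>. \<eta> \<xi> * w \<xi>) \<xi>
           + a * (deriv ^^ 3) w \<xi> + b * \<sigma> * (deriv ^^ 3) \<eta> \<xi> = 0) \<Longrightarrow>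
      degree (smult (- \<sigma>) E + W + E * W + smult (a * l\<^sup>2) (cn_op m W)
        + smult (b * \<sigma> * l\<^sup>2) (cn_op m E)) = 0" (is "PROP ?P1 \<Longrightarrow> degree ?R1 = 0")
    and "(\<And>\<xi>. - \<sigma> * deriv w \<xi> + deriv \<eta> \<xi> + w \<xi> * deriv w \<xi>
           + c * (deriv ^^ 3) \<eta> \<xi> + d * \<sigma> * (deriv ^^ 3) w \<xi> = 0) \<Longrightarrow>
      degree (smult (- \<sigma>) W + E + smult (1/2) (W * W) + smult (c * l\<^sup>2) (cn_op m E)
        + smult (d * \<sigma> * l\<^sup>2) (cn_op m W)) = 0" (is "PROP ?P2 \<Longrightarrow> degree ?R2 = 0")
proof -
  note D = deriv_poly_cn[OF m] deriv3_poly_cn[OF m]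
  have \<eta>w: "(\<lambda>\<xi>. \<eta> \<xi> * w \<xi>) = (\<lambda>x. poly (E * W) (jacobi_cn (l * x) m))"
    by (simp add: \<eta> w)
  note pd = pderiv_add pderiv_smult pderiv_mult pderiv_minus
  show "degree ?R1 = 0" if "PROP ?P1"
  proof -
    have "pderiv ?R1 = 0"
    proof (rule poly_cn_identity[OF m l])
      show "l * poly (pderiv ?R1) (jacobi_cn (l * x) m) * jacobi_cn_deriv (l * x) m = 0" for x
        using that[of x] unfolding \<eta>w unfolding \<eta> w D pd
        by (simp add: algebra_simps)
    qed
    then show ?thesis by (simp only: pderiv_eq_0_iff)
  qed
  show "degree ?R2 = 0" if "PROP ?P2"
  proof -
    have "pderiv ?R2 = 0"
    proof (rule poly_cn_identity[OF m l])
      show "l * poly (pderiv ?R2) (jacobi_cn (l * x) m) * jacobi_cn_deriv (l * x) m = 0" for x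
        using that[of x] unfolding \<eta> w D pd
        by (simp add: algebra_simps)
    qed
    then show ?thesis by (simp only: pderiv_eq_0_iff)
  qed
qed

theorem theorem3p1:
  fixes a b c d lam m \<sigma> :: real
    and n :: nat
    and j k :: "nat \<Rightarrow> real"
    and \<eta> w :: "real \<Rightarrow> real"
  assumes "abcd_admissible a b c d" and "c \<noteq> 0"
    and "lam > 0" and "0 < m" and "m \<le> 1"
    and "\<And>r. r > n \<Longrightarrow> j r = 0" and "\<And>r. r > n \<Longrightarrow> k r = 0"
    and "\<And>\<xi>. \<eta> \<xi> = (\<Sum>r=0..n. j r * jacobi_cn (lam * \<xi>) m ^ r)"
    and "\<And>\<xi>. w \<xi> = (\<Sum>r=0..n. k r * jacobi_cn (lam * \<xi>) m ^ r)"
    and "\<And>\<xi>. - \<sigma> * deriv \<eta> \<xi> + deriv w \<xi> + deriv (\<lambda>\<xi>. \<eta> \<xi> * w \<xi>) \<xi>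
           + a * (deriv ^^ 3) w \<xi> + b * \<sigma> * (deriv ^^ 3) \<eta> \<xi> = 0"
    and "\<And>\<xi>. - \<sigma> * deriv w \<xi> + deriv \<eta> \<xi> + w \<xi> * deriv w \<xi>
           + c * (deriv ^^ 3) \<eta> \<xi> + d * \<sigma> * (deriv ^^ 3) w \<xi> = 0"
  shows "(a\<^sup>2 + b\<^sup>2 \<noteq> 0 \<longrightarrow>
            (\<forall>r\<ge>3. j r = 0 \<and> k r = 0) \<and>
            (\<forall>\<xi>. \<eta> \<xi> = j 0 + j 1 * jacobi_cn (lam * \<xi>) m + j 2 * (jacobi_cn (lam * \<xi>) m)\<^sup>2) \<and>
            (\<forall>\<xi>. w \<xi> = k 0 + k 1 * jacobi_cn (lam * \<xi>) m + k 2 * (jacobi_cn (lam * \<xi>) m)\<^sup>2))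
       \<and> (a\<^sup>2 + b\<^sup>2 = 0 \<longrightarrow>
            (\<forall>r\<ge>1. j r = 0) \<and> (\<forall>r\<ge>3. k r = 0) \<and>
            (\<forall>\<xi>. \<eta> \<xi> = j 0) \<and>
            (\<forall>\<xi>. w \<xi> = k 0 + k 1 * jacobi_cn (lam * \<xi>) m + k 2 * (jacobi_cn (lam * \<xi>) m)\<^sup>2) \<and>
            \<not> (\<not> \<eta> constant_on UNIV \<and> \<not> w constant_on UNIV))"
proof -
  have m: "0 \<le> m" "m \<le> 1" "m \<noteq> 0" and l: "lam \<noteq> 0" using assms(3-5) by auto
  \<comment> \<open>As \<open>j\<close> and \<open>k\<close> vanish beyond \<open>n\<close>, they
    agree with the coefficients of \<open>E\<close> and \<open>W\<close> at every index, so degree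
    bounds become vanishing statements.\<close>
  define E where "E = (\<Sum>r\<le>n. monom (j r) r)"
  define W where "W = (\<Sum>r\<le>n. monom (k r) r)"
  have coeff: "coeff E r = j r" "coeff W r = k r" for r
    using assms(6)[of r] assms(7)[of r] by (auto simp: E_def W_def coeff_sum not_le)
  have \<eta>: "\<eta> = (\<lambda>x. poly E (jacobi_cn (lam * x) m))"
    and w: "w = (\<lambda>x. poly W (jacobi_cn (lam * x) m))"
    using assms(8,9) by (auto simp: E_def W_def poly_sum poly_monom atMost_atLeast0)
  note eqs = poly_travelling_wave[OF m(1,2) l \<eta> w]
  note eq1 = eqs(1)[of \<sigma> a b, OF assms(10)]
  note eq2 = eqs(2)[of \<sigma> c d, OF assms(11)]
  have c: "c * lam\<^sup>2 \<noteq> 0" using assms(2) l by simp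
  note deg = degree_le_two[OF m(3) c eq1 eq2]
  have high: "j r = 0 \<and> k r = 0" if "r \<ge> 3" for r
    using deg that coeff_eq_0[of E r] coeff_eq_0[of W r] by (simp add: coeff)
  have quadratic: "poly p y = coeff p 0 + coeff p 1 * y + coeff p 2 * y\<^sup>2"
    if "degree p \<le> 2" for p and y :: real
    using arg_cong[OF poly_as_sum_of_monoms'[OF that], of "\<lambda>q. poly q y"]
    by (simp add: poly_sum poly_monom numeral_2_eq_2)
  have \<eta>2: "\<eta> \<xi> = j 0 + j 1 * jacobi_cn (lam * \<xi>) m + j 2 * (jacobi_cn (lam * \<xi>) m)\<^sup>2"
    and w2: "w \<xi> = k 0 + k 1 * jacobi_cn (lam * \<xi>) m + k 2 * (jacobi_cn (lam * \<xi>) m)\<^sup>2" for \<xi>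
    by (simp_all add: \<eta> w quadratic deg coeff)
  have semitrivial: "j r = 0" if "a\<^sup>2 + b\<^sup>2 = 0" "r \<ge> 1" for r
  proof -
    have "a = 0" "b = 0" using that(1) by (auto simp: sum_power2_eq_zero_iff)
    \<comment> \<open>With \<open>a = b = 0\<close> both \<open>cn_op\<close> terms drop out of the
      first identity, leaving the factorable form.\<close>
    then have "degree E = 0"
      using degree_eq_zero[OF m(3) c _ eq2] eq1 by simp
    then show ?thesis using coeff_eq_0[of E r] that(2) by (simp add: coeff)
  qed
  then have const: "\<eta> \<xi> = j 0" if "a\<^sup>2 + b\<^sup>2 = 0" for \<xi>
    using \<eta>2[of \<xi>] that by simp
  show ?thesis
    using high \<eta>2 w2 semitrivial const by (auto simp: constant_on_def)
qed

end
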